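(* The sequence $\eta$ is generic for the probability $\nu_{\mathscr{B}}$, i.e. for any cylinder set $C\subset X$, $$\frac1N\sum_{0\le n<N}\mathbf{1}_C(S^n\eta)\longrightarrow\nu_{\mathscr{B}}(C)\qquad\text{as }N\to\infty.$$
   Context: $\mathbb{N}^*=\{1,2,3,\ldots\}$. $\mathscr{B}=\{b_k:k\ge1\}\subset\{2,3,4,\ldots\}$ is a given infinite set of pairwise relatively prime integers with $\sum_{k\ge1}1/b_k<\infty$. $X=\{0,1\}^{\mathbb{N}^*}$, and $S:X\to X$ is the shift, $(Sx)_n=x_{n+1}$. A cylinder set is a subset of $X$ obtained by prescribing the values of finitely many coordinates. The sequence $\eta=(\eta_n)_{n\in\mathbb{N}^*}\in X$ is defined by $\eta_n=0$ if some $b_k$ divides $n$, and $\eta_n=1$ otherwise. $\Omega=\prod_{k\ge1}\mathbb{Z}/b_k\mathbb{Z}$ with normalized Haar measure $\mathbb{P}$. The map $\varphi:\Omega\to X$ is defined by: $\varphi(\omega)_n=0$ if there exists $k\ge1$ with $\omega_k+n\equiv0\bmod b_k$, and $\varphi(\omega)_n=1$ otherwise ($n\in\mathbb{N}^*$). $\nu_{\mathscr{B}}$ is the pushforward of $\mathbb{P}$ by $\varphi$: $\nu_{\mathscr{B}}(C)=\mathbb{P}(\varphi^{-1}C)$. *)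

theory Defs
  imports
    "HOL-Probability.Probability"
    "HOL-Algebra.Elementary_Groups"
    "HOL-Algebra.Product_Groups"
    "HOL-Number_Theory.Cong"
begin

text \<open>
  The positive integers are the set \<^term>\<open>{1..} :: nat set\<close>; sequences indexed by them are
  extensional functions (equal to \<^const>\<open>undefined\<close> at the index 0).
\<close>

definition seq_space :: "(nat \<Rightarrow> nat) set" where
  "seq_space = (\<Pi>\<^sub>E n\<in>{1..}. {0, 1})"

definition seq_measurable_space :: "(nat \<Rightarrow> nat) measure" where
  "seq_measurable_space = (\<Pi>\<^sub>M n\<in>{1..}. count_space {0, 1})"

definition shift :: "(nat \<Rightarrow> nat) \<Rightarrow> (nat \<Rightarrow> nat)" where
  "shift x = (\<lambda>n\<in>{1..}. x (n + 1))"

definition cylinder_set :: "(nat \<Rightarrow> nat) set \<Rightarrow> bool" where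
  "cylinder_set C \<longleftrightarrow>
     (\<exists>F a. finite F \<and> F \<subseteq> {1..} \<and> a \<in> F \<rightarrow> {0, 1} \<and> C = {x \<in> seq_space. \<forall>n\<in>F. x n = a n})"

definition eta :: "(nat \<Rightarrow> nat) \<Rightarrow> (nat \<Rightarrow> nat)" where
  "eta b = (\<lambda>n\<in>{1..}. if \<exists>k\<ge>1. b k dvd n then 0 else 1)"

definition Omega_group :: "(nat \<Rightarrow> nat) \<Rightarrow> (nat \<Rightarrow> int) monoid" where
  "Omega_group b = product_group {1..} (\<lambda>k. integer_mod_group (b k))"

definition Omega_topology :: "(nat \<Rightarrow> nat) \<Rightarrow> (nat \<Rightarrow> int) topology" where
  "Omega_topology b =
     product_topology (\<lambda>k. discrete_topology (carrier (integer_mod_group (b k)))) {1..}"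

text \<open>
  Left-invariant Borel probability measures. No regularity condition is imposed, as it is automatic
  for the compact metrizable group considered here.
\<close>
definition normalized_haar_measure ::
    "('a, 'm) monoid_scheme \<Rightarrow> 'a topology \<Rightarrow> 'a measure \<Rightarrow> bool" where
  "normalized_haar_measure G T P \<longleftrightarrow>
     space P = carrier G \<and>
     sets P = sigma_sets (topspace T) {U. openin T U} \<and>
     emeasure P (space P) = 1 \<and>
     (\<forall>g\<in>carrier G. \<forall>A\<in>sets P. emeasure P ((\<lambda>x. g \<otimes>\<^bsub>G\<^esub> x) ` A) = emeasure P A)"

text \<open>
  Existence and uniqueness, for positive \<^term>\<open>b k\<close>, are established in
  \<open>normalized_haar_measure_Omega_iff\<close> below.
\<close>
definition Omega_haar :: "(nat \<Rightarrow> nat) \<Rightarrow> (nat \<Rightarrow> int) measure" where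
  "Omega_haar b = (THE P. normalized_haar_measure (Omega_group b) (Omega_topology b) P)"

definition phi :: "(nat \<Rightarrow> nat) \<Rightarrow> (nat \<Rightarrow> int) \<Rightarrow> (nat \<Rightarrow> nat)" where
  "phi b \<omega> = (\<lambda>n\<in>{1..}. if \<exists>k\<ge>1. [\<omega> k + int n = 0] (mod int (b k)) then 0 else 1)"

definition nu :: "(nat \<Rightarrow> nat) \<Rightarrow> (nat \<Rightarrow> nat) measure" where
  "nu b = distr (Omega_haar b) seq_measurable_space (phi b)"

definition generic_for :: "(nat \<Rightarrow> nat) \<Rightarrow> (nat \<Rightarrow> nat) measure \<Rightarrow> bool" where
  "generic_for x \<mu> \<longleftrightarrow>
     (\<forall>C. cylinder_set C \<longrightarrow>
        (\<lambda>N. 1 / real N * (\<Sum>n<N. indicator C ((shift ^^ n) x))) \<longlonglongrightarrow> measure \<mu> C)"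


subsection \<open>The Haar measure as a product of uniform measures\<close>

definition Omega_prod :: "(nat \<Rightarrow> nat) \<Rightarrow> (nat \<Rightarrow> int) measure" where
  "Omega_prod b = (\<Pi>\<^sub>M k\<in>{1..}. uniform_count_measure (carrier (integer_mod_group (b k))))"

lemma space_Omega_prod: "space (Omega_prod b) = (\<Pi>\<^sub>E k\<in>{1..}. carrier (integer_mod_group (b k)))"
  by (simp add: Omega_prod_def space_PiM space_uniform_count_measure)

lemma carrier_Omega_group: "carrier (Omega_group b) = (\<Pi>\<^sub>E k\<in>{1..}. carrier (integer_mod_group (b k)))"
  by (simp add: Omega_group_def)

lemma topspace_Omega: "topspace (Omega_topology b) = (\<Pi>\<^sub>E k\<in>{1..}. carrier (integer_mod_group (b k)))"
  by (simp add: Omega_topology_def)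

lemma group_Omega: "group (Omega_group b)"
  by (simp add: Omega_group_def)

lemma carrier_Zmod: "n \<ge> 1 \<Longrightarrow> carrier (integer_mod_group n) = {0..<int n}"
  by (simp add: carrier_integer_mod_group)

lemma prob_space_uniform_Zmod:
  assumes "n \<ge> 1"
  shows "prob_space (uniform_count_measure (carrier (integer_mod_group n)))"
  using assms by (intro prob_space_uniform_count_measure) (auto simp: carrier_Zmod)

lemma prob_space_Omega_prod:
  assumes "\<And>k. k \<ge> 1 \<Longrightarrow> b k \<ge> 1"
  shows "prob_space (Omega_prod b)"
  unfolding Omega_prod_def using assms by (intro prob_space_PiM prob_space_uniform_Zmod) auto

lemma sets_Omega_prod:
  assumes pos: "\<And>k. k \<ge> 1 \<Longrightarrow> b k \<ge> 1"
  shows "sets (Omega_prod b) = sigma_sets (topspace (Omega_topology b)) {U. openin (Omega_topology b) U}"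
proof -
  define Z where "Z = (\<lambda>k. carrier (integer_mod_group (b k)))"
  define \<Omega> where "\<Omega> = (\<Pi>\<^sub>E k\<in>{1..}. Z k)"
  define M where "M = (\<lambda>k. uniform_count_measure (Z k))"
  have fin: "finite (Z k)" if "k \<ge> 1" for k
    using pos[OF that] by (simp add: Z_def carrier_Zmod)
  have sM: "space (M k) = Z k" "sets (M k) = Pow (Z k)" for k
    by (auto simp: M_def space_uniform_count_measure sets_uniform_count_measure)
  have PM: "Omega_prod b = PiM {1..} M"
    by (simp add: Omega_prod_def M_def Z_def)
  have gen: "sets (Omega_prod b) =
      sigma_sets \<Omega> {{f \<in> \<Omega>. f i \<in> A} |i A. i \<in> {1..} \<and> A \<in> sets (M i)}"
    unfolding PM sets_PiM_single by (simp add: sM \<Omega>_def)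
  have top: "topspace (Omega_topology b) = \<Omega>"
    by (simp add: topspace_Omega \<Omega>_def Z_def)
  have opn: "openin (Omega_topology b) {f \<in> \<Omega>. f i \<in> A}" if "i \<in> {1..}" "A \<in> sets (M i)" for i A
  proof -
    have "openin (Omega_topology b) {f \<in> topspace (Omega_topology b). f i \<in> A}"
      using that
      by (intro openin_continuous_map_preimage[where Y = "discrete_topology (Z i)"])
         (auto simp: Omega_topology_def Z_def sM intro!: continuous_map_product_projection)
    then show ?thesis by (simp add: top)
  qed
  have meas: "U \<in> sets (Omega_prod b)" if U: "openin (Omega_topology b) U" for U
  proof -
    have US: "U \<subseteq> \<Omega>"
      using openin_subset[OF U] by (simp add: top)
    define cyl where "cyl = (\<lambda>m z. {y \<in> \<Omega>. \<forall>i\<in>{1..m}. y i = z i})"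
    define D where "D = (\<Union>m. (cyl m) ` (\<Pi>\<^sub>E i\<in>{1..m::nat}. Z i))"
    have cD: "countable D"
    proof -
      have "finite (\<Pi>\<^sub>E i\<in>{1..m}. Z i)" for m :: nat
        by (rule finite_PiE) (use fin in auto)
      then show ?thesis
        unfolding D_def by (auto intro!: countable_UN intro: countable_finite)
    qed
    have cylm: "cyl m z \<in> sets (Omega_prod b)" for m z
    proof -
      have eq: "cyl m z = {y \<in> space (Omega_prod b). \<forall>i\<in>{1..m}. y i \<in> {z i} \<inter> Z i}"
        by (auto simp: cyl_def PM space_PiM sM \<Omega>_def PiE_iff)
      have "{y \<in> space (Omega_prod b). y i \<in> {z i} \<inter> Z i} \<in> sets (Omega_prod b)" if "i \<in> {1..m}" for i
        unfolding PM using that by (intro sets_Collect_single) (auto simp: sM)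
      then show ?thesis
        unfolding eq by (intro sets.sets_Collect_finite_All) auto
    qed
    have "U = \<Union>{C \<in> D. C \<subseteq> U}"
    proof
      show "U \<subseteq> \<Union>{C \<in> D. C \<subseteq> U}"
      proof
        fix x assume x: "x \<in> U"
        obtain V where V: "finite {i \<in> {1..}. V i \<noteq> Z i}" "x \<in> Pi\<^sub>E {1..} V" "Pi\<^sub>E {1..} V \<subseteq> U"
          using U[unfolded Omega_topology_def openin_product_topology_alt] x
          by (auto simp: Z_def)
        obtain m where m: "{i \<in> {1..}. V i \<noteq> Z i} \<subseteq> {..m}"
          using V(1) finite_nat_iff_bounded_le by blast
        have xO: "x \<in> \<Omega>" using x US by auto
        have "cyl m (restrict x {1..m}) \<subseteq> Pi\<^sub>E {1..} V"
        proof
          fix y assume y: "y \<in> cyl m (restrict x {1..m})"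
          show "y \<in> Pi\<^sub>E {1..} V"
          proof (rule PiE_I)
            fix i :: nat assume i: "i \<in> {1..}"
            show "y i \<in> V i"
            proof (cases "i \<le> m")
              case True
              then have "y i = x i" using y i by (auto simp: cyl_def)
              then show ?thesis using V(2) i by auto
            next
              case False
              then have "i \<notin> {i \<in> {1..}. V i \<noteq> Z i}" using m by (meson atMost_iff subsetD)
              then have "V i = Z i" using i by blast
              then show ?thesis using y i by (auto simp: cyl_def \<Omega>_def)
            qed
          next
            fix i :: nat assume "i \<notin> {1..}"
            then show "y i = undefined" using y by (auto simp: cyl_def \<Omega>_def PiE_iff extensional_def)
          qed
        qed
        moreover have "restrict x {1..m} \<in> (\<Pi>\<^sub>E i\<in>{1..m}. Z i)"
          using xO by (auto simp: \<Omega>_def)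
        then have "cyl m (restrict x {1..m}) \<in> D"
          unfolding D_def by blast
        moreover have "x \<in> cyl m (restrict x {1..m})"
          using xO by (auto simp: cyl_def)
        ultimately show "x \<in> \<Union>{C \<in> D. C \<subseteq> U}" using V(3) by blast
      qed
    qed auto
    moreover have "\<Union>{C \<in> D. C \<subseteq> U} \<in> sets (Omega_prod b)"
    proof (rule sets.countable_Union)
      show "countable {C \<in> D. C \<subseteq> U}"
        by (rule countable_subset[OF _ cD]) blast
    qed (auto simp: D_def cylm)
    ultimately show ?thesis by simp
  qed
  show ?thesis
  proof
    show "sets (Omega_prod b) \<subseteq> sigma_sets (topspace (Omega_topology b)) {U. openin (Omega_topology b) U}"
      unfolding gen top by (rule sigma_sets_mono') (use opn in blast)
    have "space (Omega_prod b) = \<Omega>"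
      by (simp add: space_Omega_prod \<Omega>_def Z_def)
    then show "sigma_sets (topspace (Omega_topology b)) {U. openin (Omega_topology b) U} \<subseteq> sets (Omega_prod b)"
      unfolding top using meas
      by (metis (no_types, lifting) mem_Collect_eq sets.sigma_sets_subset subsetI)
  qed
qed

lemma mult_Omega_apply:
  "k \<ge> 1 \<Longrightarrow> (x \<otimes>\<^bsub>Omega_group b\<^esub> y) k = (x k + y k) mod int (b k)"
  by (simp add: Omega_group_def)

lemma mult_Omega_commute: "x \<otimes>\<^bsub>Omega_group b\<^esub> y = y \<otimes>\<^bsub>Omega_group b\<^esub> x"
  by (auto simp: Omega_group_def add.commute intro!: ext)

lemma measurable_mult_Omega:
  assumes "\<And>k. k \<ge> 1 \<Longrightarrow> b k \<ge> 1"
  shows "(\<lambda>(x, y). x \<otimes>\<^bsub>Omega_group b\<^esub> y) \<in> (Omega_prod b \<Otimes>\<^sub>M Omega_prod b) \<rightarrow>\<^sub>M Omega_prod b"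
proof -
  define Z where "Z = (\<lambda>k. carrier (integer_mod_group (b k)))"
  have comp: "(\<lambda>x. x k) \<in> Omega_prod b \<rightarrow>\<^sub>M count_space (Z k)" if "k \<in> {1..}" for k
  proof -
    have "(\<lambda>x. x k) \<in> Omega_prod b \<rightarrow>\<^sub>M uniform_count_measure (Z k)"
      unfolding Omega_prod_def Z_def using that by (intro measurable_component_singleton)
    then show ?thesis
      by (simp add: measurable_def space_uniform_count_measure sets_uniform_count_measure)
  qed
  have "(\<lambda>p. \<lambda>k\<in>{1..}. (fst p k + snd p k) mod int (b k)) \<in>
          (Omega_prod b \<Otimes>\<^sub>M Omega_prod b) \<rightarrow>\<^sub>M (\<Pi>\<^sub>M k\<in>{1..}. uniform_count_measure (Z k))"
  proof (rule measurable_restrict)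
    fix k :: nat assume k: "k \<in> {1..}"
    have cZ: "countable (Z k)" "countable (Z k \<times> Z k)"
      by (auto intro: countable_SIGMA)
    have "(\<lambda>p. (fst p k, snd p k)) \<in> (Omega_prod b \<Otimes>\<^sub>M Omega_prod b) \<rightarrow>\<^sub>M
            (count_space (Z k) \<Otimes>\<^sub>M count_space (Z k))"
      by (intro measurable_Pair measurable_compose[OF measurable_fst comp[OF k]]
                measurable_compose[OF measurable_snd comp[OF k]])
    then have 1: "(\<lambda>p. (fst p k, snd p k)) \<in> (Omega_prod b \<Otimes>\<^sub>M Omega_prod b) \<rightarrow>\<^sub>M
            count_space (Z k \<times> Z k)"
      using cZ by (simp add: pair_measure_countable)
    have 2: "(\<lambda>(u, v). (u + v) mod int (b k)) \<in> count_space (Z k \<times> Z k) \<rightarrow>\<^sub>M uniform_count_measure (Z k)"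
      using assms[of k] k
      by (auto simp: space_uniform_count_measure Z_def carrier_Zmod)
    show "(\<lambda>p. (fst p k + snd p k) mod int (b k)) \<in>
        (Omega_prod b \<Otimes>\<^sub>M Omega_prod b) \<rightarrow>\<^sub>M uniform_count_measure (Z k)"
      using measurable_compose[OF 1 2] by simp
  qed
  then show ?thesis
    by (simp add: Omega_group_def Omega_prod_def Z_def case_prod_beta)
qed

lemma (in group) translation_image_eq:
  assumes "g \<in> carrier G" "A \<subseteq> carrier G"
  shows "(\<lambda>x. g \<otimes> x) ` A = {x \<in> carrier G. inv g \<otimes> x \<in> A}"
proof (intro Set.set_eqI iffI)
  fix x assume "x \<in> {x \<in> carrier G. inv g \<otimes> x \<in> A}"
  then have "x \<in> carrier G" "inv g \<otimes> x \<in> A" by auto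
  moreover from this assms have "x = g \<otimes> (inv g \<otimes> x)"
    by (simp add: m_assoc[symmetric])
  ultimately show "x \<in> (\<lambda>x. g \<otimes> x) ` A" by blast
qed (use assms in \<open>auto simp: m_assoc[symmetric] subset_iff\<close>)

lemma card_translate_Zmod:
  assumes "n \<ge> 1" "A \<subseteq> {0..<int n}"
  shows "card {x \<in> {0..<int n}. (g + x) mod int n \<in> A} = card A"
proof (rule bij_betw_same_card)
  have 1: "(g + (x - g) mod int n) mod int n = x" if "x \<in> {0..<int n}" for x
    using that by (simp add: mod_simps)
  have 2: "((g + x) mod int n - g) mod int n = x" if "x \<in> {0..<int n}" for x
    using that by (simp add: mod_simps)
  show "bij_betw (\<lambda>x. (g + x) mod int n) {x \<in> {0..<int n}. (g + x) mod int n \<in> A} A"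
    by (rule bij_betw_byWitness[where f' = "\<lambda>x. (x - g) mod int n"]) (use assms 1 2 in \<open>auto simp: subset_iff\<close>)
qed

lemma normalized_haar_measure_Omega_prod:
  assumes pos: "\<And>k. k \<ge> 1 \<Longrightarrow> b k \<ge> 1"
  shows "normalized_haar_measure (Omega_group b) (Omega_topology b) (Omega_prod b)"
proof -
  interpret G: group "Omega_group b" by (rule group_Omega)
  interpret P: prob_space "Omega_prod b" using pos by (rule prob_space_Omega_prod)
  define Z where "Z = (\<lambda>k. carrier (integer_mod_group (b k)))"
  define M where "M = (\<lambda>k. uniform_count_measure (Z k))"
  have PM: "Omega_prod b = PiM {1..} M"
    by (simp add: Omega_prod_def M_def Z_def)
  have sM: "space (M k) = Z k" "sets (M k) = Pow (Z k)" for k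
    by (auto simp: M_def space_uniform_count_measure sets_uniform_count_measure)
  have ZE: "Z k = {0..<int (b k)}" if "k \<ge> 1" for k
    using pos[OF that] by (simp add: Z_def carrier_Zmod)
  have prM: "prob_space (M k)" if "k \<in> {1..}" for k
    using that pos[of k] by (simp add: M_def Z_def prob_space_uniform_Zmod)
  have spc: "space (Omega_prod b) = carrier (Omega_group b)"
    by (simp add: space_Omega_prod carrier_Omega_group)
  have tm: "(\<lambda>x. g \<otimes>\<^bsub>Omega_group b\<^esub> x) \<in> Omega_prod b \<rightarrow>\<^sub>M Omega_prod b"
    if "g \<in> carrier (Omega_group b)" for g
    using measurable_compose[OF measurable_Pair1'[of g "Omega_prod b" "Omega_prod b"]
                            measurable_mult_Omega[of b, OF pos]] that
    by (simp add: spc)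
  have inv: "distr (Omega_prod b) (Omega_prod b) (\<lambda>x. g \<otimes>\<^bsub>Omega_group b\<^esub> x) = Omega_prod b"
    if g: "g \<in> carrier (Omega_group b)" for g
  proof (rule measure_eqI_PiM_infinite[where I = "{1..}" and M = M])
    show "finite_measure (distr (Omega_prod b) (Omega_prod b) (\<lambda>x. g \<otimes>\<^bsub>Omega_group b\<^esub> x))"
      using tm[OF g] by (intro P.finite_measure_distr)
    fix A and J :: "nat set"
    assume J: "finite J" "J \<subseteq> {1..}" and A: "\<And>i. i \<in> J \<Longrightarrow> A i \<in> sets (M i)"
    define A' where "A' = (\<lambda>k. {x \<in> Z k. (g k + x) mod int (b k) \<in> A k})"
    have A': "\<And>i. i \<in> J \<Longrightarrow> A' i \<in> sets (M i)"
      by (auto simp: A'_def sM)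
    have emb: "prod_emb {1..} M J (Pi\<^sub>E J A) \<in> sets (Omega_prod b)"
      unfolding PM using J A by (intro sets_PiM_I) auto
    have pre: "(\<lambda>x. g \<otimes>\<^bsub>Omega_group b\<^esub> x) -` prod_emb {1..} M J (Pi\<^sub>E J A) \<inter> space (Omega_prod b)
        = prod_emb {1..} M J (Pi\<^sub>E J A')"
    proof (intro Set.set_eqI)
      fix x
      show "x \<in> (\<lambda>x. g \<otimes>\<^bsub>Omega_group b\<^esub> x) -` prod_emb {1..} M J (Pi\<^sub>E J A) \<inter> space (Omega_prod b)
        \<longleftrightarrow> x \<in> prod_emb {1..} M J (Pi\<^sub>E J A')"
      proof (cases "x \<in> carrier (Omega_group b)")
        case True
        then have gx: "g \<otimes>\<^bsub>Omega_group b\<^esub> x \<in> carrier (Omega_group b)"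
          using g by blast
        have xk: "x k \<in> Z k" if "k \<in> J" for k
          using True that J by (auto simp: carrier_Omega_group Z_def)
        have "x \<in> prod_emb {1..} M J (Pi\<^sub>E J A') \<longleftrightarrow> (\<forall>k\<in>J. x k \<in> A' k)"
          using True by (auto simp: prod_emb_def sM carrier_Omega_group Z_def restrict_PiE_iff)
        also have "\<dots> \<longleftrightarrow> (\<forall>k\<in>J. (g \<otimes>\<^bsub>Omega_group b\<^esub> x) k \<in> A k)"
        proof (rule ball_cong[OF refl])
          fix k assume "k \<in> J"
          then have "k \<ge> 1" using J by auto
          then show "x k \<in> A' k \<longleftrightarrow> (g \<otimes>\<^bsub>Omega_group b\<^esub> x) k \<in> A k"
            using xk[OF \<open>k \<in> J\<close>] by (simp add: A'_def mult_Omega_apply)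
        qed
        also have "\<dots> \<longleftrightarrow> g \<otimes>\<^bsub>Omega_group b\<^esub> x \<in> prod_emb {1..} M J (Pi\<^sub>E J A)"
          using gx by (auto simp: prod_emb_def sM carrier_Omega_group Z_def restrict_PiE_iff)
        finally show ?thesis using True by (simp add: spc)
      next
        case False
        then show ?thesis
          by (auto simp: spc prod_emb_def sM carrier_Omega_group Z_def)
      qed
    qed
    have "emeasure (distr (Omega_prod b) (Omega_prod b) (\<lambda>x. g \<otimes>\<^bsub>Omega_group b\<^esub> x))
        (prod_emb {1..} M J (Pi\<^sub>E J A)) = emeasure (PiM {1..} M) (prod_emb {1..} M J (Pi\<^sub>E J A'))"
      unfolding emeasure_distr[OF tm[OF g] emb] pre by (simp only: PM)
    also have "\<dots> = (\<Prod>k\<in>J. emeasure (M k) (A' k))"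
      using J A' by (intro emeasure_PiM_emb prM) auto
    also have "\<dots> = (\<Prod>k\<in>J. emeasure (M k) (A k))"
    proof (rule prod.cong[OF refl])
      fix k assume k: "k \<in> J"
      then have k1: "k \<ge> 1" using J by auto
      have Ak: "A k \<subseteq> {0..<int (b k)}" using A[OF k] ZE[OF k1] by (simp add: sM)
      have "card (A' k) = card (A k)"
        unfolding A'_def ZE[OF k1] by (rule card_translate_Zmod[OF pos[OF k1] Ak])
      moreover have "A' k \<subseteq> {0..<int (b k)}" by (auto simp: A'_def ZE[OF k1])
      ultimately show "emeasure (M k) (A' k) = emeasure (M k) (A k)"
        using Ak by (simp add: M_def ZE[OF k1] emeasure_uniform_count_measure)
    qed
    also have "\<dots> = emeasure (PiM {1..} M) (prod_emb {1..} M J (Pi\<^sub>E J A))"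
      using J A by (intro emeasure_PiM_emb[symmetric] prM) auto
    finally show "emeasure (distr (Omega_prod b) (Omega_prod b) (\<lambda>x. g \<otimes>\<^bsub>Omega_group b\<^esub> x))
        (prod_emb {1..} M J (Pi\<^sub>E J A)) = emeasure (Omega_prod b) (prod_emb {1..} M J (Pi\<^sub>E J A))"
      by (simp add: PM)
  qed (simp_all add: PM)
  show ?thesis
    unfolding normalized_haar_measure_def
  proof (intro conjI ballI)
    fix g A assume g: "g \<in> carrier (Omega_group b)" and A: "A \<in> sets (Omega_prod b)"
    have AG: "A \<subseteq> carrier (Omega_group b)"
      using sets.sets_into_space[OF A] by (simp add: spc)
    have ig: "inv\<^bsub>Omega_group b\<^esub> g \<in> carrier (Omega_group b)" using g by simp
    have "emeasure (Omega_prod b) ((\<lambda>x. g \<otimes>\<^bsub>Omega_group b\<^esub> x) ` A)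
        = emeasure (distr (Omega_prod b) (Omega_prod b) (\<lambda>x. inv\<^bsub>Omega_group b\<^esub> g \<otimes>\<^bsub>Omega_group b\<^esub> x)) A"
      unfolding G.translation_image_eq[OF g AG] emeasure_distr[OF tm[OF ig] A]
      by (rule arg_cong2[where f = emeasure]) (auto simp: spc)
    then show "emeasure (Omega_prod b) ((\<lambda>x. g \<otimes>\<^bsub>Omega_group b\<^esub> x) ` A) = emeasure (Omega_prod b) A"
      by (simp add: inv[OF ig])
  qed (use spc sets_Omega_prod[of b, OF pos] P.emeasure_space_1 in auto)
qed

lemma normalized_haar_measure_vimage:
  assumes H: "normalized_haar_measure G T P" and "group G"
    and g: "g \<in> carrier G" and A: "A \<in> sets P"
  shows "emeasure P {x \<in> carrier G. g \<otimes>\<^bsub>G\<^esub> x \<in> A} = emeasure P A"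
proof -
  interpret group G by fact
  have AG: "A \<subseteq> carrier G"
    using sets.sets_into_space[OF A] H by (simp add: normalized_haar_measure_def)
  have "{x \<in> carrier G. g \<otimes>\<^bsub>G\<^esub> x \<in> A} = (\<lambda>x. inv\<^bsub>G\<^esub> g \<otimes>\<^bsub>G\<^esub> x) ` A"
    using translation_image_eq[of "inv\<^bsub>G\<^esub> g" A] g AG by simp
  then show ?thesis
    using H g A by (simp add: normalized_haar_measure_def)
qed

lemma normalized_haar_measure_Omega_iff:
  assumes pos: "\<And>k. k \<ge> 1 \<Longrightarrow> b k \<ge> 1"
  shows "normalized_haar_measure (Omega_group b) (Omega_topology b) P \<longleftrightarrow> P = Omega_prod b"
proof
  assume H: "normalized_haar_measure (Omega_group b) (Omega_topology b) P"
  let ?Q = "Omega_prod b"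
  have HQ: "normalized_haar_measure (Omega_group b) (Omega_topology b) ?Q"
    using pos by (rule normalized_haar_measure_Omega_prod)
  have sP: "sets P = sets ?Q" and spc: "space P = carrier (Omega_group b)" "space ?Q = carrier (Omega_group b)"
    using H HQ by (auto simp: normalized_haar_measure_def)
  interpret P: prob_space P
    using H by (intro prob_spaceI) (auto simp only: normalized_haar_measure_def)
  interpret Q: prob_space ?Q using pos by (rule prob_space_Omega_prod)
  interpret PQ: pair_sigma_finite P ?Q ..
  show "P = ?Q"
  proof (rule measure_eqI)
    fix A assume A: "A \<in> sets P"
    define X where "X = (\<lambda>(x, y). x \<otimes>\<^bsub>Omega_group b\<^esub> y) -` A \<inter> space (P \<Otimes>\<^sub>M ?Q)"
    have "(\<lambda>(x, y). x \<otimes>\<^bsub>Omega_group b\<^esub> y) \<in> (P \<Otimes>\<^sub>M ?Q) \<rightarrow>\<^sub>M ?Q"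
      using measurable_mult_Omega[of b, OF pos] sP
      by (metis (no_types, lifting) measurable_cong_sets sets_pair_measure_cong)
    then have X: "X \<in> sets (P \<Otimes>\<^sub>M ?Q)"
      unfolding X_def using A sP by (intro measurable_sets) auto
    have "emeasure (P \<Otimes>\<^sub>M ?Q) X = (\<integral>\<^sup>+x. emeasure ?Q (Pair x -` X) \<partial>P)"
      by (rule Q.emeasure_pair_measure_alt[OF X])
    also have "\<dots> = (\<integral>\<^sup>+x. emeasure ?Q A \<partial>P)"
    proof (rule nn_integral_cong)
      fix x assume x: "x \<in> space P"
      have "Pair x -` X = {y \<in> carrier (Omega_group b). x \<otimes>\<^bsub>Omega_group b\<^esub> y \<in> A}"
        using x by (auto simp: X_def space_pair_measure spc)
      then show "emeasure ?Q (Pair x -` X) = emeasure ?Q A"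
        using normalized_haar_measure_vimage[OF HQ group_Omega] x A sP spc by simp
    qed
    finally have 1: "emeasure (P \<Otimes>\<^sub>M ?Q) X = emeasure ?Q A"
      by (simp add: P.emeasure_space_1)
    have "emeasure (P \<Otimes>\<^sub>M ?Q) X = (\<integral>\<^sup>+y. emeasure P ((\<lambda>x. (x, y)) -` X) \<partial>?Q)"
      by (rule PQ.emeasure_pair_measure_alt2[OF X])
    also have "\<dots> = (\<integral>\<^sup>+y. emeasure P A \<partial>?Q)"
    proof (rule nn_integral_cong)
      fix y assume y: "y \<in> space ?Q"
      have "(\<lambda>x. (x, y)) -` X = {x \<in> carrier (Omega_group b). y \<otimes>\<^bsub>Omega_group b\<^esub> x \<in> A}"
        using y by (auto simp: X_def space_pair_measure spc mult_Omega_commute[of b y])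
      then show "emeasure P ((\<lambda>x. (x, y)) -` X) = emeasure P A"
        using normalized_haar_measure_vimage[OF H group_Omega] y A spc by simp
    qed
    finally have 2: "emeasure (P \<Otimes>\<^sub>M ?Q) X = emeasure P A"
      by (simp add: Q.emeasure_space_1)
    show "emeasure P A = emeasure ?Q A" using 1 2 by simp
  qed (rule sP)
qed (use normalized_haar_measure_Omega_prod[of b, OF pos] in auto)

lemma Omega_haar_eq:
  assumes pos: "\<And>k. k \<ge> 1 \<Longrightarrow> b k \<ge> 1"
  shows "Omega_haar b = Omega_prod b"
  unfolding Omega_haar_def by (rule the_equality) (simp_all add: normalized_haar_measure_Omega_iff[of b, OF pos])


subsection \<open>Measurability of the coding map\<close>

lemma space_seq_measurable_space: "space seq_measurable_space = seq_space"
  by (simp add: seq_measurable_space_def seq_space_def space_PiM)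

lemma cylinder_set_measurable:
  assumes "cylinder_set C"
  shows "C \<in> sets seq_measurable_space"
proof -
  obtain F a where F: "finite F" "F \<subseteq> {1..}" "a \<in> F \<rightarrow> {0, 1}" "C = {x \<in> seq_space. \<forall>n\<in>F. x n = a n}"
    using assms by (auto simp: cylinder_set_def)
  have eq: "C = {x \<in> space seq_measurable_space. \<forall>n\<in>F. x n \<in> {a n}}"
    by (auto simp: F space_seq_measurable_space)
  have "{x \<in> space seq_measurable_space. x n \<in> {a n}} \<in> sets seq_measurable_space" if "n \<in> F" for n
    unfolding seq_measurable_space_def using that F by (intro sets_Collect_single) auto
  then show ?thesis
    unfolding eq using F(1) by (intro sets.sets_Collect_finite_All) auto
qed

lemma measurable_phi:
  assumes pos: "\<And>k. k \<ge> 1 \<Longrightarrow> b k \<ge> 1"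
  shows "phi b \<in> Omega_haar b \<rightarrow>\<^sub>M seq_measurable_space"
proof -
  have comp: "{\<omega> \<in> space (Omega_prod b). [\<omega> k + int n = 0] (mod int (b k))} \<in> sets (Omega_prod b)"
    if "k \<ge> 1" for k n
  proof -
    have "{\<omega> \<in> space (Omega_prod b). [\<omega> k + int n = 0] (mod int (b k))} =
      {\<omega> \<in> space (Omega_prod b).
         \<omega> k \<in> {z \<in> carrier (integer_mod_group (b k)). [z + int n = 0] (mod int (b k))}}"
      using that by (auto simp: space_Omega_prod)
    also have "\<dots> \<in> sets (Omega_prod b)"
      unfolding Omega_prod_def using that
      by (intro sets_Collect_single) (auto simp: sets_uniform_count_measure)
    finally show ?thesis .
  qed
  have "(\<lambda>\<omega>. \<lambda>n\<in>{1..}. if \<exists>k\<ge>1. [\<omega> k + int n = 0] (mod int (b k)) then 0 else 1) \<in>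
          Omega_prod b \<rightarrow>\<^sub>M (\<Pi>\<^sub>M n\<in>{1..}. count_space {0, 1 :: nat})"
  proof (intro measurable_restrict measurable_If)
    fix n :: nat
    have "{\<omega> \<in> space (Omega_prod b). \<exists>k. k \<ge> 1 \<and> [\<omega> k + int n = 0] (mod int (b k))} \<in> sets (Omega_prod b)"
    proof (rule sets.sets_Collect_countable_Ex)
      fix k
      show "{\<omega> \<in> space (Omega_prod b). k \<ge> 1 \<and> [\<omega> k + int n = 0] (mod int (b k))} \<in> sets (Omega_prod b)"
        using comp[of k n] by (cases "k \<ge> 1") auto
    qed
    then show "{\<omega> \<in> space (Omega_prod b). \<exists>k\<ge>1. [\<omega> k + int n = 0] (mod int (b k))} \<in> sets (Omega_prod b)" .
  qed auto
  moreover have "Omega_haar b = Omega_prod b"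
    using pos by (rule Omega_haar_eq)
  ultimately show ?thesis
    by (simp only: seq_measurable_space_def phi_def[abs_def])
qed

lemma prob_space_nu:
  assumes pos: "\<And>k. k \<ge> 1 \<Longrightarrow> b k \<ge> 1"
  shows "prob_space (nu b)"
proof -
  have "prob_space (Omega_haar b)"
    using prob_space_Omega_prod[of b, OF pos] by (simp add: Omega_haar_eq[of b, OF pos])
  then interpret prob_space "Omega_haar b" .
  show ?thesis
    unfolding nu_def by (rule prob_space_distr[OF measurable_phi[of b, OF pos]])
qed

end

theory Submission
  imports Defs
begin

text \<open>
  Keep only the first \<open>K\<close> moduli. The occurrence of a given pattern at position \<open>n\<close> then depends on
  the residues of \<open>n\<close> modulo \<open>b 1, \<dots>, b K\<close> only, so it is periodic in \<open>n\<close>, and by the Chinese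
  remainder theorem its frequency over one period is the Haar measure of the corresponding event.
  The error made in the frequency is at most a constant times \<open>\<Sum>k>K. 1 / b k\<close>, uniformly in the
  length \<open>N\<close> of the averaging window, so the limits in \<open>N\<close> and \<open>K\<close> can be interchanged; on the side
  of the measure the limit in \<open>K\<close> is dominated convergence.
\<close>

section \<open>Patterns determined by residues\<close>

text \<open>
  With \<open>A = {1..}\<close> this says that \<open>phi b \<omega>\<close> agrees with \<open>a\<close> on \<open>F\<close>; the constant family
  \<open>\<omega> = (\<lambda>_. int n)\<close> stands for the \<open>n\<close>-fold shift of \<open>eta b\<close>.
\<close>
definition sieve_pattern ::
    "(nat \<Rightarrow> nat) \<Rightarrow> nat set \<Rightarrow> nat set \<Rightarrow> (nat \<Rightarrow> nat) \<Rightarrow> (nat \<Rightarrow> int) \<Rightarrow> bool" where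
  "sieve_pattern b A F a \<omega> \<longleftrightarrow>
     (\<forall>m\<in>F. (if \<exists>k\<in>A. [\<omega> k + int m = 0] (mod int (b k)) then 0 else 1) = a m)"

text \<open>This serves both to replace a point \<omega> by an integer with the same residues and to
  see that the pattern is periodic in \<open>n\<close>.\<close>

lemma sieve_pattern_cong:
  assumes "\<And>k. k \<in> A \<Longrightarrow> [\<omega> k = \<omega>' k] (mod int (b k))"
  shows "sieve_pattern b A F a \<omega> \<longleftrightarrow> sieve_pattern b A F a \<omega>'"
proof -
  have "[\<omega> k + int m = 0] (mod int (b k)) \<longleftrightarrow> [\<omega>' k + int m = 0] (mod int (b k))"
    if "k \<in> A" for k m
    using assms[OF that] by (meson cong_add cong_refl cong_sym cong_trans)
  then show ?thesis
    by (simp add: sieve_pattern_def cong: bex_cong)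
qed

lemma sieve_pattern_const_iff:
  "sieve_pattern b A F a (\<lambda>_. int n) \<longleftrightarrow>
     (\<forall>m\<in>F. (if \<exists>k\<in>A. b k dvd n + m then 0 else 1) = a m)"
proof -
  have "[int n + int m = 0] (mod int (b k)) \<longleftrightarrow> b k dvd n + m" for m k
    by (metis cong_0_iff int_dvd_int_iff of_nat_add)
  then show ?thesis by (simp add: sieve_pattern_def)
qed

section \<open>Means of periodic sequences\<close>

lemma sum_lessThan_add_period:
  fixes f :: "nat \<Rightarrow> 'a::comm_monoid_add"
  assumes "\<And>n. f (n + q) = f n"
  shows "sum f {..<N + q} = sum f {..<N} + sum f {..<q}"
proof (induction N)
  case (Suc N)
  then show ?case by (simp add: assms ac_simps)
qed simp

text \<open>Subtracting the linear growth \<open>N * S / q\<close> from the partial sums leaves a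
  \<open>q\<close>-periodic, hence bounded, function, which vanishes in the limit after division by
  \<open>N\<close>.\<close>

lemma periodic_mean_tendsto:
  fixes f :: "nat \<Rightarrow> real"
  assumes per: "\<And>n. f (n + q) = f n" and q: "q > 0"
  shows "(\<lambda>N. 1 / real N * sum f {..<N}) \<longlonglongrightarrow> sum f {..<q} / real q"
proof -
  define S where "S = sum f {..<q}"
  define g where "g N = sum f {..<N} - real N * S / real q" for N
  have g_add: "g (N + q) = g N" for N
    using q sum_lessThan_add_period[of f q N, OF per]
    by (simp add: g_def S_def field_simps)
  have g_add_mult: "g (N + j * q) = g N" for N j
  proof (induction j)
    case (Suc j)
    then show ?case using g_add[of "N + j * q"] by (simp add: ac_simps)
  qed simp
  have g_mod: "g N = g (N mod q)" for N
    using g_add_mult[of "N mod q" "N div q"] by simp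
  have "finite (g ` {..<q})" by simp
  then have "bounded (g ` {..<q})" by (rule finite_imp_bounded)
  then obtain D where D: "\<And>n. n < q \<Longrightarrow> norm (g n) \<le> D"
    by (auto simp: bounded_iff)
  have bd: "norm (g N) \<le> D" for N
    using D[of "N mod q"] q by (simp add: g_mod[of N])
  have "(\<lambda>N. 1 / real N * g N) \<longlonglongrightarrow> 0"
  proof (rule tendsto_0_le[where K = D])
    show "(\<lambda>N. 1 / real N) \<longlonglongrightarrow> 0" by (rule lim_1_over_n)
    show "\<forall>\<^sub>F N in sequentially. norm (1 / real N * g N) \<le> norm (1 / real N) * D"
      using bd by (intro always_eventually allI) (simp only: norm_mult mult_left_mono norm_ge_zero)
  qed
  then have "(\<lambda>N. S / real q + 1 / real N * g N) \<longlonglongrightarrow> S / real q"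
    using tendsto_add[OF tendsto_const[of "S / real q"]] by fastforce
  \<comment> \<open>At \<open>N = 0\<close> the right side is 0 because \<open>1 / 0 = 0\<close>, so
    the identity is claimed only eventually.\<close>
  moreover have "\<forall>\<^sub>F N in sequentially.
      S / real q + 1 / real N * g N = 1 / real N * sum f {..<N}"
    using eventually_gt_at_top[of 0]
    by eventually_elim (use q in \<open>simp add: g_def field_simps\<close>)
  ultimately show ?thesis
    unfolding S_def by (rule Lim_transform_eventually)
qed

section \<open>Haar measure of finitely sieved patterns\<close>

text \<open>Each \<open>k\<close> in \<open>A\<close> confines \<omega> to one residue class out of
  \<open>b k\<close>, and the coordinates are independent under the product measure.\<close>

lemma
  fixes b :: "nat \<Rightarrow> nat"
  assumes pos: "\<And>k. k \<ge> 1 \<Longrightarrow> b k \<ge> 1" and A: "finite A" "A \<subseteq> {1..}"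
  shows sets_residue_cylinder:
      "{\<omega> \<in> space (Omega_prod b). \<forall>k\<in>A. [\<omega> k = int n] (mod int (b k))} \<in> sets (Omega_prod b)"
      (is "?C \<in> _")
    and measure_residue_cylinder:
      "measure (Omega_prod b) {\<omega> \<in> space (Omega_prod b). \<forall>k\<in>A. [\<omega> k = int n] (mod int (b k))} =
         1 / real (\<Prod>k\<in>A. b k)"
proof -
  define M where "M = (\<lambda>k. uniform_count_measure (carrier (integer_mod_group (b k))))"
  define X where "X = (\<lambda>k. {int n mod int (b k)})"
  have PM: "Omega_prod b = PiM {1..} M"
    by (simp add: Omega_prod_def M_def)
  have car: "carrier (integer_mod_group (b k)) = {0..<int (b k)}" if "k \<ge> 1" for k
    using pos[OF that] by (simp add: carrier_Zmod)
  have X: "X k \<in> sets (M k)" and mX: "emeasure (M k) (X k) = ennreal (1 / real (b k))"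
    if "k \<in> A" for k
  proof -
    have k: "k \<ge> 1" using that A by auto
    have sub: "X k \<subseteq> {0..<int (b k)}" using pos[OF k] by (simp add: X_def)
    show "X k \<in> sets (M k)"
      using sub by (simp add: M_def sets_uniform_count_measure car[OF k])
    show "emeasure (M k) (X k) = ennreal (1 / real (b k))"
      using sub by (simp add: M_def car[OF k] emeasure_uniform_count_measure X_def)
  qed
  have "?C = prod_emb {1..} M A (Pi\<^sub>E A X)"
  proof (intro Set.set_eqI)
    fix \<omega>
    \<comment> \<open>Coordinates of points of the space are reduced representatives, so the
      congruence is an equality with \<open>int n mod int (b k)\<close>.\<close>
    have "[\<omega> k = int n] (mod int (b k)) \<longleftrightarrow> \<omega> k \<in> X k"
      if "\<omega> \<in> space (Omega_prod b)" "k \<in> A" for k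
    proof -
      have k: "k \<ge> 1" using that A by auto
      then have "\<omega> k \<in> {0..<int (b k)}"
        using that car[OF k] by (auto simp: space_Omega_prod PiE_iff)
      then show ?thesis by (simp add: cong_def X_def)
    qed
    then show "\<omega> \<in> ?C \<longleftrightarrow> \<omega> \<in> prod_emb {1..} M A (Pi\<^sub>E A X)"
      by (auto simp: prod_emb_def PM space_PiM restrict_PiE_iff)
  qed
  moreover have "prod_emb {1..} M A (Pi\<^sub>E A X) \<in> sets (Omega_prod b)"
    unfolding PM using A X by (intro sets_PiM_I) auto
  moreover have "measure (Omega_prod b) (prod_emb {1..} M A (Pi\<^sub>E A X)) = 1 / real (\<Prod>k\<in>A. b k)"
  proof -
    have "emeasure (PiM {1..} M) (prod_emb {1..} M A (Pi\<^sub>E A X)) = (\<Prod>k\<in>A. emeasure (M k) (X k))"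
      using A X pos by (intro emeasure_PiM_emb) (auto simp: M_def prob_space_uniform_Zmod)
    also have "\<dots> = ennreal (\<Prod>k\<in>A. 1 / real (b k))"
      by (simp add: mX prod_ennreal)
    finally show ?thesis
      unfolding PM measure_def by (simp add: prod_nonneg prod_dividef)
  qed
  ultimately show "?C \<in> sets (Omega_prod b)" "measure (Omega_prod b) ?C = 1 / real (\<Prod>k\<in>A. b k)"
    by auto
qed

text \<open>By the Chinese remainder theorem the cylinders \<open>cyl n\<close>, for
  \<open>n < q\<close> with \<open>q\<close> the product of the moduli, partition the space. The
  pattern is constant on each, so the event is the disjoint union of those \<open>cyl n\<close>
  whose \<open>n\<close> shows the pattern, each of measure \<open>1 / q\<close>.\<close>

lemma
  fixes b :: "nat \<Rightarrow> nat"
  assumes pos: "\<And>k. k \<ge> 1 \<Longrightarrow> b k \<ge> 1" and A: "finite A" "A \<subseteq> {1..}"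
    and cop: "\<And>i j. i \<in> A \<Longrightarrow> j \<in> A \<Longrightarrow> i \<noteq> j \<Longrightarrow> coprime (b i) (b j)"
  shows sets_sieve_pattern:
      "{\<omega> \<in> space (Omega_prod b). sieve_pattern b A F a \<omega>} \<in> sets (Omega_prod b)" (is "?E \<in> _")
    and measure_sieve_pattern:
      "measure (Omega_prod b) {\<omega> \<in> space (Omega_prod b). sieve_pattern b A F a \<omega>} =
         (\<Sum>n<\<Prod>k\<in>A. b k. of_bool (sieve_pattern b A F a (\<lambda>_. int n))) / real (\<Prod>k\<in>A. b k)"
proof -
  interpret prob_space "Omega_prod b" using pos by (rule prob_space_Omega_prod)
  define q where "q = (\<Prod>k\<in>A. b k)"
  define cyl where
    "cyl n = {\<omega> \<in> space (Omega_prod b). \<forall>k\<in>A. [\<omega> k = int n] (mod int (b k))}" for n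
  define R where "R = {n \<in> {..<q}. sieve_pattern b A F a (\<lambda>_. int n)}"
  have cyl: "cyl n \<in> sets (Omega_prod b)" "measure (Omega_prod b) (cyl n) = 1 / real q" for n
    unfolding cyl_def q_def
    using sets_residue_cylinder[of b, OF pos A] measure_residue_cylinder[of b, OF pos A] by auto
  have E: "?E = (\<Union>n\<in>R. cyl n)"
  proof (intro equalityI subsetI)
    fix \<omega> assume "\<omega> \<in> ?E"
    then have \<omega>: "\<omega> \<in> space (Omega_prod b)" "sieve_pattern b A F a \<omega>" by auto
    have "\<forall>k\<in>A. b k \<noteq> 0" using pos A by force
    \<comment> \<open>The remainder theorem is applied over the naturals, hence
      \<open>nat (\<omega> k)\<close>; nonnegativity of the coordinates undoes the conversion
      below.\<close>
    then obtain n where n: "n < q" "\<forall>k\<in>A. [n = nat (\<omega> k)] (mod b k)"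
      using chinese_remainder_unique_nat[OF A(1), of b "\<lambda>k. nat (\<omega> k)"] cop
      unfolding q_def by blast
    have c: "[\<omega> k = int n] (mod int (b k))" if k: "k \<in> A" for k
    proof -
      have "k \<ge> 1" using k A by auto
      then have "\<omega> k \<in> carrier (integer_mod_group (b k))"
        using \<omega>(1) by (auto simp: space_Omega_prod PiE_iff)
      then have "\<omega> k \<ge> 0"
        using carrier_Zmod[OF pos[OF \<open>k \<ge> 1\<close>]] by simp
      then show ?thesis
        using n(2) k by (metis cong_int_iff cong_sym nat_0_le)
    qed
    then have "sieve_pattern b A F a (\<lambda>_. int n)"
      using \<omega>(2) sieve_pattern_cong[of A \<omega> "\<lambda>_. int n"] by blast
    then show "\<omega> \<in> (\<Union>n\<in>R. cyl n)"
      using n(1) c \<omega>(1) by (auto simp: R_def cyl_def)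
  next
    fix \<omega> assume "\<omega> \<in> (\<Union>n\<in>R. cyl n)"
    then obtain n where "n \<in> R" "\<omega> \<in> cyl n" by blast
    then show "\<omega> \<in> ?E"
      using sieve_pattern_cong[of A \<omega> "\<lambda>_. int n" b F a] by (simp add: R_def cyl_def)
  qed
  \<comment> \<open>A common point makes \<open>m\<close> and \<open>n\<close> congruent modulo
    every \<open>b k\<close>, hence modulo \<open>q\<close> by coprimality; both are below
    \<open>q\<close>, so they coincide.\<close>
  have disj: "disjoint_family_on cyl R"
    unfolding disjoint_family_on_def
  proof (intro ballI impI, rule ccontr)
    fix m n assume mn: "m \<in> R" "n \<in> R" "m \<noteq> n" and "cyl m \<inter> cyl n \<noteq> {}"
    then obtain \<omega> where "\<forall>k\<in>A. [\<omega> k = int m] (mod int (b k))" "\<forall>k\<in>A. [\<omega> k = int n] (mod int (b k))"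
      by (auto simp: cyl_def)
    then have "[m = n] (mod b k)" if "k \<in> A" for k
      using that by (metis cong_int_iff cong_sym cong_trans)
    then have "[m = n] (mod q)"
      unfolding q_def using cop by (intro coprime_cong_prod_nat) auto
    then show False using mn by (simp add: R_def cong_less_modulus_unique_nat)
  qed
  have "finite R" by (simp add: R_def)
  then show "?E \<in> sets (Omega_prod b)"
    unfolding E using cyl by (intro sets.finite_UN) auto
  have "measure (Omega_prod b) ?E = (\<Sum>n\<in>R. measure (Omega_prod b) (cyl n))"
    unfolding E using cyl disj \<open>finite R\<close> by (intro finite_measure_finite_Union) auto
  also have "\<dots> = (\<Sum>n<q. of_bool (sieve_pattern b A F a (\<lambda>_. int n))) / real q"
    by (simp add: cyl(2) R_def sum_of_bool_eq Int_def)
  finally show "measure (Omega_prod b) ?E =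
      (\<Sum>n<\<Prod>k\<in>A. b k. of_bool (sieve_pattern b A F a (\<lambda>_. int n))) / real (\<Prod>k\<in>A. b k)"
    unfolding q_def .
qed

text \<open>Adding the product of the moduli to \<open>n\<close> changes no residue, so the
  indicator is periodic, and its mean over one period is the measure just computed.\<close>

lemma sieve_pattern_mean_tendsto:
  fixes b :: "nat \<Rightarrow> nat"
  assumes pos: "\<And>k. k \<ge> 1 \<Longrightarrow> b k \<ge> 1" and A: "finite A" "A \<subseteq> {1..}"
    and cop: "\<And>i j. i \<in> A \<Longrightarrow> j \<in> A \<Longrightarrow> i \<noteq> j \<Longrightarrow> coprime (b i) (b j)"
  shows "(\<lambda>N. 1 / real N * (\<Sum>n<N. of_bool (sieve_pattern b A F a (\<lambda>_. int n))))
    \<longlonglongrightarrow> measure (Omega_prod b) {\<omega> \<in> space (Omega_prod b). sieve_pattern b A F a \<omega>}"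
proof -
  have "measure (Omega_prod b) {\<omega> \<in> space (Omega_prod b). sieve_pattern b A F a \<omega>} =
      (\<Sum>n<\<Prod>k\<in>A. b k. of_bool (sieve_pattern b A F a (\<lambda>_. int n))) / real (\<Prod>k\<in>A. b k)"
    using pos A cop by (rule measure_sieve_pattern)
  also have "(\<lambda>N. 1 / real N * (\<Sum>n<N. of_bool (sieve_pattern b A F a (\<lambda>_. int n)))) \<longlonglongrightarrow> \<dots>"
  proof (rule periodic_mean_tendsto)
    fix n
    have "[int (n + (\<Prod>k\<in>A. b k)) = int n] (mod int (b k))" if "k \<in> A" for k
    proof -
      have "b k dvd (\<Prod>k\<in>A. b k)" using A(1) that by (rule dvd_prodI)
      then show ?thesis by (auto simp: cong_iff_dvd_diff simp del: of_nat_prod)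
    qed
    then show "of_bool (sieve_pattern b A F a (\<lambda>_. int (n + (\<Prod>k\<in>A. b k)))) =
        (of_bool (sieve_pattern b A F a (\<lambda>_. int n)) :: real)"
      using sieve_pattern_cong[of A "\<lambda>_. int (n + (\<Prod>k\<in>A. b k))" "\<lambda>_. int n" b F a] by auto
  next
    show "0 < (\<Prod>k\<in>A. b k)" using pos A by (intro prod_pos) force
  qed
  finally show ?thesis .
qed

section \<open>Truncation error, uniform in the window length\<close>

text \<open>Starting the interval at 1 excludes the multiple 0, so no additive constant appears;
  such a constant could not be summed over infinitely many moduli.\<close>

lemma card_multiples_le:
  assumes "d > 0"
  shows "real (card {j \<in> {1..L}. d dvd j}) \<le> real L / real d"
proof -
  have "{j \<in> {1..L}. d dvd j} = (\<lambda>i. d * i) ` {1..L div d}"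
  proof (intro equalityI subsetI)
    fix j assume "j \<in> {j \<in> {1..L}. d dvd j}"
    then obtain i where "j = d * i" "j \<ge> 1" "j \<le> L" by auto
    then show "j \<in> (\<lambda>i. d * i) ` {1..L div d}"
      using assms by (auto simp: less_eq_div_iff_mult_less_eq ac_simps Suc_le_eq)
  qed (use assms in \<open>auto simp: less_eq_div_iff_mult_less_eq ac_simps Suc_le_eq\<close>)
  also have "card \<dots> \<le> L div d"
    using card_image_le[of "{1..L div d}" "\<lambda>i. d * i"] by simp
  finally show ?thesis
    using of_nat_div_le_of_nat[of L d, where 'a = real] by linarith
qed

text \<open>A union bound over the moduli beyond \<open>K\<close>. The term at index 0, where
  \<open>b\<close> is arbitrary, occurs in both sums on the right and cancels.\<close>

lemma card_tail_multiples_le: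
  fixes b :: "nat \<Rightarrow> nat"
  assumes pos: "\<And>k. k > K \<Longrightarrow> b k \<ge> 1" and sm: "summable (\<lambda>k. 1 / real (b k))"
  shows "real (card {j \<in> {1..L}. \<exists>k>K. b k dvd j}) \<le>
    real L * ((\<Sum>k. 1 / real (b k)) - (\<Sum>k\<le>K. 1 / real (b k)))"
proof -
  define T where "T = {j \<in> {1..L}. \<exists>k>K. b k dvd j}"
  \<comment> \<open>One witness per element of the finite set \<open>T\<close> reduces the union
    over all \<open>k > K\<close> to one over the finite set \<open>J\<close>.\<close>
  obtain c where c: "\<And>j. j \<in> T \<Longrightarrow> c j > K \<and> b (c j) dvd j"
    using bchoice[of T "\<lambda>j k. k > K \<and> b k dvd j"] unfolding T_def by blast
  define J where "J = c ` T"
  have fin: "finite T" "finite J" by (auto simp: T_def J_def)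
  have JK: "k > K" if "k \<in> J" for k using that c by (auto simp: J_def)
  have "T \<subseteq> (\<Union>k\<in>J. {j \<in> {1..L}. b k dvd j})"
    using c by (auto simp: J_def T_def)
  then have "card T \<le> card (\<Union>k\<in>J. {j \<in> {1..L}. b k dvd j})"
    using fin by (intro card_mono) auto
  also have "\<dots> \<le> (\<Sum>k\<in>J. card {j \<in> {1..L}. b k dvd j})"
    using fin by (intro card_UN_le)
  finally have "real (card T) \<le> (\<Sum>k\<in>J. real (card {j \<in> {1..L}. b k dvd j}))"
    by (metis of_nat_le_iff of_nat_sum)
  also have "\<dots> \<le> (\<Sum>k\<in>J. real L * (1 / real (b k)))"
    using card_multiples_le[of "b k" L for k] pos JK by (intro sum_mono) fastforce
  also have "\<dots> = real L * (\<Sum>k\<in>J. 1 / real (b k))"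
    by (simp only: sum_distrib_left)
  also have "\<dots> \<le> real L * ((\<Sum>k. 1 / real (b k)) - (\<Sum>k\<le>K. 1 / real (b k)))"
  proof (rule mult_left_mono)
    have "(\<Sum>k\<in>J. 1 / real (b k)) + (\<Sum>k\<le>K. 1 / real (b k)) = (\<Sum>k\<in>J \<union> {..K}. 1 / real (b k))"
      using JK fin by (intro sum.union_disjoint[symmetric]) force+
    also have "\<dots> \<le> (\<Sum>k. 1 / real (b k))"
      using fin by (intro sum_le_suminf sm) auto
    finally show "(\<Sum>k\<in>J. 1 / real (b k)) \<le> (\<Sum>k. 1 / real (b k)) - (\<Sum>k\<le>K. 1 / real (b k))"
      by simp
  qed simp
  finally show ?thesis unfolding T_def .
qed

text \<open>Truncation can change the pattern at \<open>n\<close> only if some \<open>n + m\<close>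
  with \<open>m\<close> in \<open>F\<close> is a multiple of a discarded modulus. For each
  \<open>m\<close> at most \<open>(N + m) * t\<close> positions are affected, where \<open>t\<close>
  is the tail of the series.\<close>

lemma sieve_pattern_truncation_error:
  fixes b :: "nat \<Rightarrow> nat"
  assumes pos: "\<And>k. k \<ge> 1 \<Longrightarrow> b k \<ge> 1" and sm: "summable (\<lambda>k. 1 / real (b k))"
    and F: "finite F" "F \<subseteq> {1..}"
  shows "\<bar>1 / real N * (\<Sum>n<N. of_bool (sieve_pattern b {1..K} F a (\<lambda>_. int n))) -
          1 / real N * (\<Sum>n<N. of_bool (sieve_pattern b {1..} F a (\<lambda>_. int n)))\<bar>
    \<le> (\<Sum>m\<in>F. 1 + real m) * ((\<Sum>k. 1 / real (b k)) - (\<Sum>k\<le>K. 1 / real (b k)))"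
proof -
  define t where "t = (\<Sum>k. 1 / real (b k)) - (\<Sum>k\<le>K. 1 / real (b k))"
  have t0: "t \<ge> 0"
    unfolding t_def using sum_le_suminf[OF sm, of "{..K}"] by simp
  define p where "p A n = (of_bool (sieve_pattern b A F a (\<lambda>_. int n)) :: real)" for A n
  have diff: "\<bar>p {1..K} n - p {1..} n\<bar> \<le> (\<Sum>m\<in>F. of_bool (\<exists>k>K. b k dvd n + m))" for n
  proof (cases "\<exists>m\<in>F. \<exists>k>K. b k dvd n + m")
    case True
    then obtain m where m: "m \<in> F" "\<exists>k>K. b k dvd n + m" by blast
    have "\<bar>p {1..K} n - p {1..} n\<bar> \<le> 1" by (simp add: p_def)
    also have "1 = (of_bool (\<exists>k>K. b k dvd n + m) :: real)" using m by simp
    also have "\<dots> \<le> (\<Sum>m\<in>F. of_bool (\<exists>k>K. b k dvd n + m))"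
      by (rule member_le_sum[OF m(1) _ F(1)]) simp
    finally show ?thesis .
  next
    case False
    then have "(\<exists>k\<in>{1..K}. b k dvd n + m) \<longleftrightarrow> (\<exists>k\<in>{1..}. b k dvd n + m)" if "m \<in> F" for m
      using that by (meson atLeastAtMost_iff atLeast_iff not_le)
    then have "p {1..K} n = p {1..} n"
      by (simp add: p_def sieve_pattern_const_iff)
    then show ?thesis by (simp add: sum_nonneg)
  qed
  have count: "(\<Sum>n<N. of_bool (\<exists>k>K. b k dvd n + m)) \<le> real (N + m) * t" if m: "m \<in> F" for m
  proof -
    have "(\<Sum>n<N. of_bool (\<exists>k>K. b k dvd n + m)) = real (card {n \<in> {..<N}. \<exists>k>K. b k dvd n + m})"
      by (simp add: sum_of_bool_eq Int_def)
    also have "card {n \<in> {..<N}. \<exists>k>K. b k dvd n + m} =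
        card ((\<lambda>n. n + m) ` {n \<in> {..<N}. \<exists>k>K. b k dvd n + m})"
      by (rule card_image[symmetric]) simp
    also have "\<dots> \<le> card {j \<in> {1..N + m}. \<exists>k>K. b k dvd j}"
      \<comment> \<open>Here \<open>m\<close> \<ge> 1 is what puts \<open>n + m\<close> into an
        interval starting at 1.\<close>
      using m F by (intro card_mono) auto
    also have "real \<dots> \<le> real (N + m) * t"
      unfolding t_def using pos sm by (intro card_tail_multiples_le) auto
    finally show ?thesis by simp
  qed
  have "\<bar>(\<Sum>n<N. p {1..K} n) - (\<Sum>n<N. p {1..} n)\<bar> \<le> (\<Sum>n<N. \<bar>p {1..K} n - p {1..} n\<bar>)"
    unfolding sum_subtractf[symmetric] by (rule sum_abs)
  also have "\<dots> \<le> (\<Sum>n<N. \<Sum>m\<in>F. of_bool (\<exists>k>K. b k dvd n + m))"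
    by (intro sum_mono diff)
  also have "\<dots> = (\<Sum>m\<in>F. \<Sum>n<N. of_bool (\<exists>k>K. b k dvd n + m))"
    by (rule sum.swap)
  also have "\<dots> \<le> (\<Sum>m\<in>F. real (N + m) * t)"
    by (intro sum_mono count)
  finally have main: "\<bar>(\<Sum>n<N. p {1..K} n) - (\<Sum>n<N. p {1..} n)\<bar> \<le> (\<Sum>m\<in>F. real (N + m) * t)" .
  have "\<bar>1 / real N * (\<Sum>n<N. p {1..K} n) - 1 / real N * (\<Sum>n<N. p {1..} n)\<bar>
      \<le> (\<Sum>m\<in>F. 1 + real m) * t"
  proof (cases "N = 0")
    case True
    then show ?thesis using t0 by (simp add: sum_nonneg)
  next
    case False
    have "\<bar>1 / real N * (\<Sum>n<N. p {1..K} n) - 1 / real N * (\<Sum>n<N. p {1..} n)\<bar>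
        = 1 / real N * \<bar>(\<Sum>n<N. p {1..K} n) - (\<Sum>n<N. p {1..} n)\<bar>"
      by (simp add: abs_mult flip: diff_divide_distrib)
    also have "\<dots> \<le> 1 / real N * (\<Sum>m\<in>F. real (N + m) * t)"
      using main by (rule mult_left_mono) simp
    also have "\<dots> = (\<Sum>m\<in>F. real (N + m) / real N * t)"
      by (simp add: sum_distrib_left)
    \<comment> \<open>Since \<open>N\<close> \<ge> 1, \<open>m / N\<close> is at most
      \<open>m\<close>; this crude bound frees the constant from \<open>N\<close>.\<close>
    also have "\<dots> \<le> (\<Sum>m\<in>F. (1 + real m) * t)"
    proof (intro sum_mono mult_right_mono t0)
      fix m
      have "real m * 1 \<le> real m * real N"
        using False by (intro mult_left_mono) auto
      then show "real (N + m) / real N \<le> 1 + real m"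
        using False by (simp add: field_simps)
    qed
    finally show ?thesis by (simp add: sum_distrib_right)
  qed
  then show ?thesis unfolding p_def t_def .
qed

section \<open>Convergence of the truncations, and translation to \<open>phi\<close> and
  \<open>eta\<close>\<close>

text \<open>If some modulus removes \<open>m\<close>, every \<open>K\<close> beyond its index
  detects it; otherwise no truncation removes \<open>m\<close>. Finiteness of \<open>F\<close> gives
  a common threshold, which may depend on \<omega>.\<close>

lemma sieve_pattern_eventually_eq:
  assumes "finite F"
  shows "\<forall>\<^sub>F K in sequentially. sieve_pattern b {1..K} F a \<omega> \<longleftrightarrow> sieve_pattern b {1..} F a \<omega>"
proof -
  have "\<forall>\<^sub>F K in sequentially. \<forall>m\<in>F.
      (\<exists>k\<in>{1..K}. [\<omega> k + int m = 0] (mod int (b k))) \<longleftrightarrow>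
      (\<exists>k\<in>{1..}. [\<omega> k + int m = 0] (mod int (b k)))"
  proof (intro eventually_ball_finite assms ballI)
    fix m
    show "\<forall>\<^sub>F K in sequentially. (\<exists>k\<in>{1..K}. [\<omega> k + int m = 0] (mod int (b k))) \<longleftrightarrow>
        (\<exists>k\<in>{1..}. [\<omega> k + int m = 0] (mod int (b k)))"
    proof (cases "\<exists>k\<in>{1..}. [\<omega> k + int m = 0] (mod int (b k))")
      case True
      then obtain k where k: "k \<ge> 1" "[\<omega> k + int m = 0] (mod int (b k))" by auto
      show ?thesis
        using eventually_ge_at_top[of k] by eventually_elim (use k in auto)
    next
      case False
      then show ?thesis by (intro always_eventually) auto
    qed
  qed
  then show ?thesis
    by eventually_elim (simp add: sieve_pattern_def)
qed

lemma phi_mem_cylinder_iff: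
  assumes "F \<subseteq> {1..}"
  shows "phi b \<omega> \<in> {x \<in> seq_space. \<forall>n\<in>F. x n = a n} \<longleftrightarrow> sieve_pattern b {1..} F a \<omega>"
proof -
  have "phi b \<omega> \<in> seq_space" by (auto simp: phi_def seq_space_def)
  moreover have "phi b \<omega> m = (if \<exists>k\<in>{1..}. [\<omega> k + int m = 0] (mod int (b k)) then 0 else 1)"
    if "m \<in> F" for m
    using that assms by (auto simp: phi_def)
  ultimately show ?thesis by (simp add: sieve_pattern_def)
qed

text \<open>Each shift reads one index further right, hence the induction with \<open>m\<close>
  arbitrary. At index 0 a shifted sequence is \<open>undefined\<close>.\<close>

lemma shift_power_apply: "m \<ge> 1 \<Longrightarrow> (shift ^^ n) x m = x (n + m)"
  by (induction n arbitrary: m) (auto simp: shift_def)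

lemma shift_power_eta_mem_cylinder_iff:
  assumes "F \<subseteq> {1..}"
  shows "(shift ^^ n) (eta b) \<in> {x \<in> seq_space. \<forall>n\<in>F. x n = a n} \<longleftrightarrow>
    sieve_pattern b {1..} F a (\<lambda>_. int n)"
proof -
  have "shift x \<in> seq_space" if "x \<in> seq_space" for x
    using that by (auto simp: seq_space_def shift_def PiE_iff)
  moreover have "eta b \<in> seq_space"
    by (auto simp: seq_space_def eta_def)
  ultimately have "(shift ^^ n) (eta b) \<in> seq_space"
    by (induction n) auto
  moreover have "(shift ^^ n) (eta b) m = (if \<exists>k\<in>{1..}. b k dvd n + m then 0 else 1)"
    if "m \<in> F" for m
  proof -
    have "m \<ge> 1" using that assms by auto
    then show ?thesis by (auto simp: shift_power_apply eta_def)
  qed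
  ultimately show ?thesis by (simp add: sieve_pattern_const_iff)
qed

section \<open>Interchange of the two limits\<close>

theorem theorem4p1:
  fixes B :: "nat set" and b :: "nat \<Rightarrow> nat"
  assumes "bij_betw b {1..} B"
    and "infinite B"
    and "B \<subseteq> {2..}"
    and "pairwise coprime B"
    and "(\<lambda>k. 1 / real (b k)) summable_on {1..}"
  shows "generic_for (eta b) (nu b)"
  unfolding generic_for_def
proof (intro allI impI)
  fix C assume C: "cylinder_set C"
  then obtain F a where F: "finite F" "F \<subseteq> {1..}" and CF: "C = {x \<in> seq_space. \<forall>n\<in>F. x n = a n}"
    by (auto simp: cylinder_set_def)
  have pos: "b k \<ge> 1" if "k \<ge> 1" for k
    using bij_betwE[OF assms(1)] assms(3) that by fastforce
  have cop: "coprime (b i) (b j)" if "i \<ge> 1" "j \<ge> 1" "i \<noteq> j" for i j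
  proof -
    have "b i \<in> B" "b j \<in> B" "b i \<noteq> b j"
      using assms(1) that by (auto simp: bij_betw_def inj_on_def)
    then show ?thesis using assms(4) by (auto simp: pairwise_def)
  qed
  \<comment> \<open>Adding the single index 0 turns the hypothesis into convergence of an ordinary
    series over \<open>nat\<close>.\<close>
  have "(\<lambda>k. 1 / real (b k)) summable_on insert 0 {1..}"
    using assms(5) by (simp add: summable_on_insert_iff)
  also have "insert 0 {1..} = (UNIV :: nat set)" by auto
  finally have sm: "summable (\<lambda>k. 1 / real (b k))"
    by (simp add: summable_on_UNIV_nonneg_real_iff)
  define t where "t K = (\<Sum>k. 1 / real (b k)) - (\<Sum>k\<le>K. 1 / real (b k))" for K
  have t: "t \<longlonglongrightarrow> 0"
    unfolding t_def
    using tendsto_diff[OF tendsto_const summable_LIMSEQ'[OF sm], of "\<Sum>k. 1 / real (b k)"] by simp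
  define E where "E A = {\<omega> \<in> space (Omega_prod b). sieve_pattern b A F a \<omega>}" for A
  define avg where
    "avg A N = 1 / real N * (\<Sum>n<N. of_bool (sieve_pattern b A F a (\<lambda>_. int n)) :: real)" for A N
  interpret prob_space "Omega_prod b" using pos by (rule prob_space_Omega_prod)
  have haar: "Omega_haar b = Omega_prod b" using pos by (rule Omega_haar_eq)
  have phi: "phi b \<in> Omega_haar b \<rightarrow>\<^sub>M seq_measurable_space"
    using pos by (rule measurable_phi)
  have vim: "phi b -` C \<inter> space (Omega_haar b) = E {1..}"
    unfolding CF using phi_mem_cylinder_iff[OF F(2)] by (auto simp: haar E_def)
  have nuC: "measure (nu b) C = prob (E {1..})"
    unfolding nu_def measure_distr[OF phi cylinder_set_measurable[OF C]] vim
    by (simp only: haar)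
  \<comment> \<open>The index set is infinite here, so measurability comes from the preimage of
    \<open>C\<close> under \<open>phi b\<close> instead of from
    \<open>sets_sieve_pattern\<close>.\<close>
  have E_sets: "E {1..} \<in> events"
    using measurable_sets[OF phi cylinder_set_measurable[OF C]]
    unfolding vim by (simp only: haar)
  have EK_sets: "E {1..K} \<in> events" for K
    unfolding E_def using pos cop by (intro sets_sieve_pattern) auto
  \<comment> \<open>The indicators converge pointwise, being eventually constant in
    \<open>K\<close>, and are dominated by 1, which is integrable for a probability measure.\<close>
  have "(\<lambda>K. expectation (indicat_real (E {1..K}))) \<longlonglongrightarrow> expectation (indicat_real (E {1..}))"
  proof (rule integral_dominated_convergence[where w = "\<lambda>_. 1"])
    show "AE \<omega> in Omega_prod b. (\<lambda>K. indicat_real (E {1..K}) \<omega>) \<longlonglongrightarrow> indicator (E {1..}) \<omega>"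
    proof (intro AE_I2 tendsto_eventually)
      fix \<omega>
      show "\<forall>\<^sub>F K in sequentially. indicat_real (E {1..K}) \<omega> = indicator (E {1..}) \<omega>"
        using sieve_pattern_eventually_eq[OF F(1), of b a \<omega>]
        by eventually_elim (simp add: E_def indicator_def)
    qed
  qed (use E_sets EK_sets in \<open>auto simp: indicator_def\<close>)
  then have prob_lim: "(\<lambda>K. prob (E {1..K})) \<longlonglongrightarrow> prob (E {1..})"
    using E_sets EK_sets by simp
  have "avg {1..} \<longlonglongrightarrow> prob (E {1..})"
  \<comment> \<open>For fixed \<open>K\<close> the averages converge in \<open>N\<close>, their
    limits converge in \<open>K\<close> by \<open>prob_lim\<close>, and the truncated averages
    approach the full ones uniformly in \<open>N\<close>.\<close>
  proof (rule swap_uniform_limit'[OF _ prob_lim])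
    show "\<forall>\<^sub>F K in sequentially. avg {1..K} \<longlonglongrightarrow> prob (E {1..K})"
      unfolding avg_def E_def using pos cop
      by (intro always_eventually allI sieve_pattern_mean_tendsto) auto
    show "uniform_limit UNIV (\<lambda>K. avg {1..K}) (avg {1..}) sequentially"
    proof (rule uniform_limitI)
      fix e :: real assume "e > 0"
      have "(\<lambda>K. (\<Sum>m\<in>F. 1 + real m) * t K) \<longlonglongrightarrow> 0"
        using tendsto_mult_right_zero[OF t] by simp
      then have "\<forall>\<^sub>F K in sequentially. (\<Sum>m\<in>F. 1 + real m) * t K < e"
        using \<open>e > 0\<close> by (rule order_tendstoD)
      then show "\<forall>\<^sub>F K in sequentially. \<forall>N\<in>UNIV. dist (avg {1..K} N) (avg {1..} N) < e"
      proof eventually_elim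
        case (elim K)
        have "dist (avg {1..K} N) (avg {1..} N) \<le> (\<Sum>m\<in>F. 1 + real m) * t K" for N
          unfolding dist_real_def avg_def t_def
          using pos sm F by (intro sieve_pattern_truncation_error) auto
        then show ?case using elim by (blast intro: le_less_trans)
      qed
    qed
  qed auto
  moreover have "indicator C ((shift ^^ n) (eta b)) =
      (of_bool (sieve_pattern b {1..} F a (\<lambda>_. int n)) :: real)" for n
    unfolding CF indicator_def shift_power_eta_mem_cylinder_iff[OF F(2)] by (simp add: of_bool_def)
  ultimately show
    "(\<lambda>N. 1 / real N * (\<Sum>n<N. indicator C ((shift ^^ n) (eta b)))) \<longlonglongrightarrow> measure (nu b) C"
    unfolding nuC avg_def by simp
qed

end
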